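(* Let $(Y,d)$ be a complete locally compact geodesic space satisfying Axiom 1 with respect to a compact metric space $(\overline{Y},\overline{d})$, and put $\partial Y=\overline{Y}\setminus Y$. Suppose that $(Y,d)$ satisfies Axiom 3. If $f:Y\rightarrow Y$ is a nonexpansive mapping without bounded orbits, then there exists $\xi\in\partial Y$ such that the iterates $f^{n}$ of $f$ converge uniformly on bounded sets of $Y$ to $\xi$.
   Context: Metric spaces are nonempty. A geodesic in $(Y,d)$ is a curve $\sigma:[a,b]\to Y$ with $d(\sigma(t_1),\sigma(t_2))=|t_1-t_2|$ for all $t_1,t_2\in[a,b]$; $Y$ is a geodesic space if every two points are joined by a geodesic. A map $f:Y\to Y$ is nonexpansive if $d(f(x),f(y))\le d(x,y)$ for all $x,y\in Y$. The orbit of $x$ is $\{f^n(x):n=1,2,\ldots\}$; "without bounded orbits" means that no orbit is bounded in $(Y,d)$. Axiom 1: $(Y,d)$ is an open dense subset of a compact metric space $(\overline{Y},\overline{d})$ whose relative topology coincides with the topology of $(Y,d)$; and for any $w\in Y$, if $\{x_n\}$ is a sequence in $Y$ converging (in $\overline{Y}$) to some $\xi\in\partial Y=\overline{Y}\setminus Y$, then $d(x_n,w)\to\infty$. Axiom 3: if $\{x_n\}$ and $\{y_n\}$ are sequences in $Y$, $x_n\to\xi\in\partial Y$, and if for some $w\in Y$, $d(x_n,y_n)-d(y_n,w)\to-\infty$, then $y_n\to\xi$. Convergence to points of $\partial Y$ is with respect to $\overline{d}$. Uniform convergence on bounded sets to $\xi$ means: for each $d$-bounded $K\subset Y$, $\sup_{y\in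 K}\overline{d}(f^n(y),\xi)\to 0$. *)

theory Defs
  imports "HOL-Analysis.Analysis"
begin

text \<open>
  A metric space is a carrier together with a distance function, as in the locale
  \<^locale>\<open>Metric_space\<close>, because the interior \<open>(Y, d)\<close> and the compact space \<open>(Yb, db)\<close> share
  points but carry different metrics.
\<close>

text \<open>The degenerate interval \<open>a = b\<close> is allowed: it joins a point to itself.\<close>

definition geodesic :: "'a set \<Rightarrow> ('a \<Rightarrow> 'a \<Rightarrow> real) \<Rightarrow> real \<Rightarrow> real \<Rightarrow> (real \<Rightarrow> 'a) \<Rightarrow> bool"
  where "geodesic Y d a b \<sigma> \<longleftrightarrow>
    a \<le> b \<and> \<sigma> \<in> {a..b} \<rightarrow> Y \<and> (\<forall>s\<in>{a..b}. \<forall>t\<in>{a..b}. d (\<sigma> s) (\<sigma> t) = \<bar>s - t\<bar>)"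

definition geodesic_space :: "'a set \<Rightarrow> ('a \<Rightarrow> 'a \<Rightarrow> real) \<Rightarrow> bool"
  where "geodesic_space Y d \<longleftrightarrow>
    (\<forall>x\<in>Y. \<forall>y\<in>Y. \<exists>a b \<sigma>. geodesic Y d a b \<sigma> \<and> \<sigma> a = x \<and> \<sigma> b = y)"

definition nonexpansive :: "'a set \<Rightarrow> ('a \<Rightarrow> 'a \<Rightarrow> real) \<Rightarrow> ('a \<Rightarrow> 'a) \<Rightarrow> bool"
  where "nonexpansive Y d f \<longleftrightarrow>
    f \<in> Y \<rightarrow> Y \<and> (\<forall>x\<in>Y. \<forall>y\<in>Y. d (f x) (f y) \<le> d x y)"

definition orbit_of :: "('a \<Rightarrow> 'a) \<Rightarrow> 'a \<Rightarrow> 'a set"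
  where "orbit_of f x = {(f ^^ n) x | n. n \<ge> 1}"

definition without_bounded_orbits :: "'a set \<Rightarrow> ('a \<Rightarrow> 'a \<Rightarrow> real) \<Rightarrow> ('a \<Rightarrow> 'a) \<Rightarrow> bool"
  where "without_bounded_orbits Y d f \<longleftrightarrow>
    (\<forall>x\<in>Y. \<not> Metric_space.mbounded Y d (orbit_of f x))"

definition axiom1 ::
  "'a set \<Rightarrow> ('a \<Rightarrow> 'a \<Rightarrow> real) \<Rightarrow> 'a set \<Rightarrow> ('a \<Rightarrow> 'a \<Rightarrow> real) \<Rightarrow> bool"
  where "axiom1 Y d Yb db \<longleftrightarrow>
    Metric_space Yb db \<and>
    compact_space (Metric_space.mtopology Yb db) \<and>
    openin (Metric_space.mtopology Yb db) Y \<and>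
    (Metric_space.mtopology Yb db) closure_of Y = Yb \<and>
    subtopology (Metric_space.mtopology Yb db) Y = Metric_space.mtopology Y d \<and>
    (\<forall>w\<in>Y. \<forall>x \<xi>. range x \<subseteq> Y \<longrightarrow> \<xi> \<in> Yb - Y \<longrightarrow>
       limitin (Metric_space.mtopology Yb db) x \<xi> sequentially \<longrightarrow>
       filterlim (\<lambda>n. d (x n) w) at_top sequentially)"

definition axiom3 ::
  "'a set \<Rightarrow> ('a \<Rightarrow> 'a \<Rightarrow> real) \<Rightarrow> 'a set \<Rightarrow> ('a \<Rightarrow> 'a \<Rightarrow> real) \<Rightarrow> bool"
  where "axiom3 Y d Yb db \<longleftrightarrow>
    (\<forall>x y \<xi>. range x \<subseteq> Y \<longrightarrow> range y \<subseteq> Y \<longrightarrow> \<xi> \<in> Yb - Y \<longrightarrow>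
       limitin (Metric_space.mtopology Yb db) x \<xi> sequentially \<longrightarrow>
       (\<exists>w\<in>Y. filterlim (\<lambda>n. d (x n) (y n) - d (y n) w) at_bot sequentially) \<longrightarrow>
       limitin (Metric_space.mtopology Yb db) y \<xi> sequentially)"

text \<open>
  The supremum is taken in \<^typ>\<open>ennreal\<close>, where it is unconditionally meaningful: the
  supremum over the empty set is \<open>0\<close>, and an unbounded family has supremum \<open>\<infinity>\<close>.
\<close>

definition iterates_converge_uniformly_on_bounded_sets ::
  "'a set \<Rightarrow> ('a \<Rightarrow> 'a \<Rightarrow> real) \<Rightarrow> ('a \<Rightarrow> 'a \<Rightarrow> real) \<Rightarrow> ('a \<Rightarrow> 'a) \<Rightarrow> 'a \<Rightarrow> bool"
  where "iterates_converge_uniformly_on_bounded_sets Y d db f \<xi> \<longleftrightarrow>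
    (\<forall>K. K \<subseteq> Y \<longrightarrow> Metric_space.mbounded Y d K \<longrightarrow>
       (\<lambda>n. SUP y\<in>K. ennreal (db ((f ^^ n) y) \<xi>)) \<longlonglongrightarrow> 0)"

end

theory Submission
  imports Defs
begin

text \<open>
  Fix a base point \<open>x\<close> and write \<open>a\<^sub>n\<close> for the distance from \<open>f\<^sup>n x\<close> to \<open>x\<close>. By Axiom 1, a bounded
  sequence in \<open>Y\<close> cannot cluster on the boundary, so bounded sets are relatively compact in \<open>Y\<close>. In such a
  space an unbounded orbit of a nonexpansive map cannot even have a bounded subsequence
  (\<open>unbounded_orbit_escapes\<close>), so \<open>a\<^sub>n\<close> tends to infinity and all limit points of the orbit
  lie on the boundary.

  There is only one limit point. Call \<open>n\<close> a record time if \<open>a\<^sub>m \<le> a\<^sub>n\<close> for all \<open>m \<le> n\<close>, and let \<open>\<xi>\<close> be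
  a limit point along record times. For \<open>k \<le> n\<close>, the points \<open>f\<^sup>n x\<close> and \<open>f\<^sup>k x\<close> are at
  distance at most \<open>a\<^bsub>n-k\<^esub> \<le> a\<^sub>n\<close>. On the other hand, Axiom 3 and the existence of geodesics
  imply that points tending to different boundary points have bounded Gromov product
  (\<open>distinct_limits_bounded_Gromov_product\<close>). If the orbit had another limit point along times \<open>k\<close>,
  the distance would thus be at least \<open>a\<^sub>n + a\<^sub>k - C\<close> with a constant \<open>C\<close>, and \<open>a\<^sub>k \<le> C\<close> would
  contradict \<open>a\<^sub>k \<rightarrow> \<infinity>\<close>. Axiom 3 carries the convergence over to bounded sets.

  Geodesics cannot be dispensed with in the second step: on the natural numbers with the metric
  \<open>ln (1 + \<bar>m - n\<bar>)\<close> the successor map is an isometry without bounded orbits, but the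
  values of \<open>sin (ln (1 + n))\<close> define a compactification satisfying both axioms whose boundary is an
  interval, every point of which is a limit point of the orbit.
\<close>

section \<open>Extracting subsequences\<close>

lemma subseq_of_frequent:
  assumes "\<And>N. \<exists>n\<ge>N. P (n::nat)"
  shows "\<exists>r::nat \<Rightarrow> nat. strict_mono r \<and> (\<forall>n. P (r n))"
proof -
  have "infinite {n. P n}"
    using assms by (auto simp: infinite_nat_iff_unbounded_le)
  from infinite_enumerate[OF this] show ?thesis by auto
qed

lemma bounded_above_subseq:
  fixes s :: "nat \<Rightarrow> real"
  assumes "\<not> filterlim s at_top sequentially"
  shows "\<exists>(r::nat \<Rightarrow> nat) C. strict_mono r \<and> (\<forall>n. s (r n) \<le> C)"
proof -
  from assms obtain C where C: "\<And>N. \<exists>n\<ge>N. \<not> C \<le> s n"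
    by (auto simp: filterlim_at_top eventually_sequentially)
  from subseq_of_frequent[of "\<lambda>n. \<not> C \<le> s n", OF C]
  obtain r :: "nat \<Rightarrow> nat" where "strict_mono r" "\<forall>n. \<not> C \<le> s (r n)" by blast
  then show ?thesis by (meson linear)
qed

lemma bounded_below_subseq:
  fixes s :: "nat \<Rightarrow> real"
  assumes "\<not> filterlim s at_bot sequentially"
  shows "\<exists>(r::nat \<Rightarrow> nat) C. strict_mono r \<and> (\<forall>n. C \<le> s (r n))"
proof -
  from assms obtain C where C: "\<And>N. \<exists>n\<ge>N. \<not> s n \<le> C"
    by (auto simp: filterlim_at_bot eventually_sequentially)
  from subseq_of_frequent[of "\<lambda>n. \<not> s n \<le> C", OF C]
  obtain r :: "nat \<Rightarrow> nat" where "strict_mono r" "\<forall>n. \<not> s (r n) \<le> C" by blast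
  then show ?thesis by (meson linear)
qed

lemma record_times_subseq:
  fixes a :: "nat \<Rightarrow> real"
  assumes "filterlim a at_top sequentially"
  shows "\<exists>r::nat \<Rightarrow> nat. strict_mono r \<and> (\<forall>n. \<forall>m\<le>r n. a m \<le> a (r n))"
proof (rule subseq_of_frequent)
  fix N :: nat
  define B where "B = Max (a ` {..N})"
  have B: "a m \<le> B" if "m \<le> N" for m
    using that by (auto simp: B_def)
  have "\<exists>n. B < a n"
    using assms by (auto simp: filterlim_at_top_dense eventually_sequentially)
  (* The first time at which a exceeds its maximum over {..N}. *)
  define n where "n = (LEAST n. B < a n)"
  have n: "B < a n" unfolding n_def using \<open>\<exists>n. B < a n\<close> by (rule LeastI_ex)
  have "a m \<le> a n" if "m \<le> n" for m
  proof (cases "m = n")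
    case False
    then have "\<not> B < a m" using that not_less_Least[of m "\<lambda>n. B < a n"] by (auto simp: n_def)
    then show ?thesis using n by simp
  qed simp
  moreover have "N \<le> n" using B[of n] n by (meson leD nle_le)
  ultimately show "\<exists>n\<ge>N. \<forall>m\<le>n. a m \<le> a n" by blast
qed

section \<open>Unbounded orbits of nonexpansive maps escape\<close>

context Metric_space
begin

lemma nonexpansive_iterate_mem:
  assumes "nonexpansive M d f" "x \<in> M"
  shows "(f ^^ n) x \<in> M"
  using assms by (induction n) (auto simp: nonexpansive_def)

lemma nonexpansive_iterate:
  assumes "nonexpansive M d f" "x \<in> M" "y \<in> M"
  shows "d ((f ^^ n) x) ((f ^^ n) y) \<le> d x y"
proof (induction n)
  case (Suc n)
  have "d (f ((f ^^ n) x)) (f ((f ^^ n) y)) \<le> d ((f ^^ n) x) ((f ^^ n) y)"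
    using assms nonexpansive_iterate_mem[OF assms(1)] by (auto simp: nonexpansive_def)
  with Suc show ?case by simp
qed simp

lemma nonexpansive_orbit_dist_le:
  assumes "nonexpansive M d f" "x \<in> M" "k \<le> n"
  shows "d ((f ^^ n) x) ((f ^^ k) x) \<le> d ((f ^^ (n - k)) x) x"
proof -
  have "(f ^^ n) x = (f ^^ k) ((f ^^ (n - k)) x)"
    using \<open>k \<le> n\<close> by (metis comp_apply funpow_add le_add_diff_inverse)
  then show ?thesis
    using nonexpansive_iterate[OF assms(1)] nonexpansive_iterate_mem[OF assms(1)] assms(2) by simp
qed

text \<open>
  If \<open>f\<^sup>i x\<close> and \<open>f\<^sup>j x\<close> with \<open>i \<le> j\<close> are both close to \<open>z\<close>, then so is the image of \<open>z\<close> after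
  \<open>j - i\<close> steps, because \<open>f\<close> iterated \<open>j - i\<close> times takes the first point to the second.
\<close>

lemma cluster_point_of_orbit_recurrent:
  assumes f: "nonexpansive M d f" and x: "x \<in> M" and z: "z \<in> M"
    and r: "strict_mono r" and lim: "(\<lambda>n. d ((f ^^ r n) x) z) \<longlonglongrightarrow> 0" and "e > 0"
  shows "\<exists>m\<ge>N. d ((f ^^ m) z) z < e"
proof -
  have "\<forall>\<^sub>F n in sequentially. d ((f ^^ r n) x) z < e/2"
    using lim \<open>e > 0\<close> by (intro order_tendstoD(2)[OF lim]) simp
  then obtain n where n: "\<And>k. k \<ge> n \<Longrightarrow> d ((f ^^ r k) x) z < e/2"
    by (auto simp: eventually_sequentially)
  define m where "m = r (n + N) - r n"
  have gap: "r n + N \<le> r (n + N)" for N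
  proof (induction N)
    case (Suc N)
    have "r (n + N) < r (n + Suc N)" using r by (simp add: strict_mono_def)
    with Suc show ?case by simp
  qed simp
  have "N \<le> m" using gap[of N] by (simp add: m_def)
  have eq: "(f ^^ r (n + N)) x = (f ^^ m) ((f ^^ r n) x)"
    unfolding m_def using gap[of N] by (metis add_leD1 comp_apply funpow_add le_add_diff_inverse2)
  have mem: "(f ^^ k) x \<in> M" "(f ^^ k) z \<in> M" for k
    using nonexpansive_iterate_mem[OF f] x z by auto
  have "d ((f ^^ m) z) z \<le> d ((f ^^ m) z) ((f ^^ m) ((f ^^ r n) x)) + d ((f ^^ r (n + N)) x) z"
    unfolding eq using triangle[of "(f ^^ m) z" "(f ^^ m) ((f ^^ r n) x)" z] mem z eq by metis
  also have "\<dots> \<le> d z ((f ^^ r n) x) + d ((f ^^ r (n + N)) x) z"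
    using nonexpansive_iterate[OF f z mem(1)] by simp
  also have "\<dots> < e" using n[of n] n[of "n + N"] by (simp add: commute)
  finally show ?thesis using \<open>N \<le> m\<close> by blast
qed

text \<open>
  Total boundedness makes the return times to the unit ball uniformly bounded: every orbit point in
  the ball is within \<open>1/2\<close> of one of finitely many, each of these finitely many returns to
  within \<open>1/2\<close> of \<open>z\<close>, and nonexpansiveness drags the neighbouring points along. Between two
  returns the orbit has no time to go far.
\<close>

lemma recurrent_orbit_bounded:
  assumes f: "nonexpansive M d f" and z: "z \<in> M"
    and tb: "mtotally_bounded (mball z 1)"
    and rec: "\<And>e N. e > 0 \<Longrightarrow> \<exists>m\<ge>N. d ((f ^^ m) z) z < e"
  shows "\<exists>B. \<forall>n. d ((f ^^ n) z) z \<le> B"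
proof -
  have mem: "(f ^^ k) y \<in> M" if "y \<in> M" for k y
    using nonexpansive_iterate_mem[OF f that] .
  define S where "S = range (\<lambda>n. (f ^^ n) z) \<inter> mball z 1"
  have "mtotally_bounded S"
    using tb by (rule mtotally_bounded_subset) (simp add: S_def)
  then obtain K where K: "finite K" "K \<subseteq> S" "S \<subseteq> (\<Union>x\<in>K. mball x (1/2))"
    unfolding mtotally_bounded_def by (metis half_gt_zero zero_less_one)
  have "\<exists>j\<ge>1. d ((f ^^ j) k) z < 1/2" if "k \<in> K" for k
  proof -
    from that K(2) obtain i where i: "k = (f ^^ i) z" by (auto simp: S_def)
    from rec[of "1/2" "i + 1"] obtain m where m: "m \<ge> i + 1" "d ((f ^^ m) z) z < 1/2" by auto
    have "(f ^^ m) z = (f ^^ (m - i)) k"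
      unfolding i using m(1) by (metis add_leD1 comp_apply funpow_add le_add_diff_inverse2)
    with m show ?thesis by (intro exI[of _ "m - i"]) auto
  qed
  then obtain \<mu> where \<mu>: "\<And>k. k \<in> K \<Longrightarrow> \<mu> k \<ge> 1 \<and> d ((f ^^ \<mu> k) k) z < 1/2"
    by metis
  define L where "L = Max (insert 0 (\<mu> ` K))"
  have return: "\<exists>j\<in>{1..L}. (f ^^ j) p \<in> S" if "p \<in> S" for p
  proof -
    from that K(3) obtain k where k: "k \<in> K" "p \<in> mball k (1/2)" by auto
    have M: "k \<in> M" "p \<in> M" using k by auto
    have "d z ((f ^^ \<mu> k) p) \<le> d z ((f ^^ \<mu> k) k) + d ((f ^^ \<mu> k) k) ((f ^^ \<mu> k) p)"
      using triangle z mem M by simp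
    also have "\<dots> \<le> d z ((f ^^ \<mu> k) k) + d k p"
      using nonexpansive_iterate[OF f M] by simp
    also have "\<dots> < 1" using \<mu>[OF k(1)] k(2) by (auto simp: commute)
    finally have "(f ^^ \<mu> k) p \<in> mball z 1" using z mem M by simp
    moreover from that obtain i where "p = (f ^^ i) z" by (auto simp: S_def)
    then have "(f ^^ \<mu> k) p = (f ^^ (\<mu> k + i)) z" by (simp add: funpow_add)
    ultimately have "(f ^^ \<mu> k) p \<in> S" by (auto simp: S_def)
    moreover have "\<mu> k \<in> {1..L}" using \<mu>[OF k(1)] k(1) K(1) by (auto simp: L_def)
    ultimately show ?thesis by blast
  qed
  have last_visit: "\<exists>i\<le>n. n - i \<le> L \<and> (f ^^ i) z \<in> S" for n
  proof (induction n)
    case 0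
    have "(f ^^ 0) z \<in> S" unfolding S_def using z by (auto intro: range_eqI[of _ _ 0])
    then show ?case by auto
  next
    case (Suc n)
    then obtain i where i: "i \<le> n" "n - i \<le> L" "(f ^^ i) z \<in> S" by blast
    show ?case
    proof (cases "Suc n - i \<le> L")
      case True
      then show ?thesis using i by (intro exI[of _ i]) auto
    next
      case False
      obtain j where j: "1 \<le> j" "j \<le> L" "(f ^^ j) ((f ^^ i) z) \<in> S"
        using return[OF i(3)] by auto
      have "(f ^^ (j + i)) z \<in> S" using j(3) by (simp add: funpow_add)
      then show ?thesis using i j False by (intro exI[of _ "j + i"]) auto
    qed
  qed
  define B where "B = Max ((\<lambda>l. d ((f ^^ l) z) z) ` {..L})"
  have "d ((f ^^ n) z) z \<le> 1 + B" for n
  proof -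
    obtain i where i: "i \<le> n" "n - i \<le> L" "(f ^^ i) z \<in> S" using last_visit by blast
    have "(f ^^ n) z = (f ^^ (n - i)) ((f ^^ i) z)"
      using i(1) by (metis comp_apply funpow_add le_add_diff_inverse2)
    then have "d ((f ^^ n) z) z
        \<le> d ((f ^^ (n - i)) ((f ^^ i) z)) ((f ^^ (n - i)) z) + d ((f ^^ (n - i)) z) z"
      using triangle z mem by metis
    also have "\<dots> \<le> d ((f ^^ i) z) z + d ((f ^^ (n - i)) z) z"
      using nonexpansive_iterate[OF f mem[OF z] z] by simp
    also have "d ((f ^^ i) z) z \<le> 1" using i(3) by (auto simp: S_def commute)
    also have "d ((f ^^ (n - i)) z) z \<le> B" using i(2) by (auto simp: B_def)
    finally show ?thesis by simp
  qed
  then show ?thesis by blast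
qed

text \<open>
  A theorem of Calka. Otherwise some subsequence of the orbit of \<open>x\<close> stays bounded and so
  clusters at a point \<open>z\<close>. This \<open>z\<close> is recurrent, so its orbit is bounded, and the orbit of \<open>x\<close>
  never gets farther from the orbit of \<open>z\<close> than \<open>d x z\<close>.
\<close>

lemma unbounded_orbit_escapes:
  assumes f: "nonexpansive M d f" and x: "x \<in> M"
    and proper: "\<And>s w R. \<lbrakk>range s \<subseteq> M; w \<in> M; \<And>n. d (s n) w \<le> R\<rbrakk>
      \<Longrightarrow> \<exists>z (r::nat \<Rightarrow> nat). z \<in> M \<and> strict_mono r \<and> (\<lambda>n. d (s (r n)) z) \<longlonglongrightarrow> 0"
    and unb: "\<not> mbounded (orbit_of f x)"
  shows "filterlim (\<lambda>n. d ((f ^^ n) x) x) at_top sequentially"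
proof (rule ccontr)
  assume "\<not> ?thesis"
  from bounded_above_subseq[OF this]
  obtain r :: "nat \<Rightarrow> nat" and C where r: "strict_mono r" and C: "\<And>n. d ((f ^^ r n) x) x \<le> C" by blast
  have mem: "(f ^^ k) y \<in> M" if "y \<in> M" for k y
    using nonexpansive_iterate_mem[OF f that] .
  from proper[of "\<lambda>n. (f ^^ r n) x" x C] obtain z and q :: "nat \<Rightarrow> nat" where z: "z \<in> M" and q: "strict_mono q"
    and lim: "(\<lambda>n. d ((f ^^ r (q n)) x) z) \<longlonglongrightarrow> 0"
    using mem[OF x] x C by (auto simp: image_subset_iff)
  have "strict_mono (r \<circ> q)" using r q by (rule strict_mono_o)
  then have rec: "\<exists>m\<ge>N. d ((f ^^ m) z) z < e" if "e > 0" for e N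
    using cluster_point_of_orbit_recurrent[OF f x z, of "r \<circ> q"] lim that by simp
  have "mtotally_bounded (mball z 1)"
    unfolding mtotally_bounded_sequentially
  proof (intro conjI allI impI)
    fix s :: "nat \<Rightarrow> 'a" assume s: "range s \<subseteq> mball z 1"
    have sM: "range s \<subseteq> M" using s by auto
    have "d (s n) z \<le> 1" for n using range_subsetD[OF s, of n] by (auto simp: commute)
    from proper[OF sM z this] obtain y and p :: "nat \<Rightarrow> nat" where "y \<in> M" "strict_mono p"
      "(\<lambda>n. d (s (p n)) y) \<longlonglongrightarrow> 0" by blast
    then have "limitin mtopology (s \<circ> p) y sequentially"
      using range_subsetD[OF sM] by (simp add: limitin_metric_dist_null o_def)
    then have "MCauchy (s \<circ> p)"
      using sM by (intro convergent_imp_MCauchy) auto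
    with \<open>strict_mono p\<close> show "\<exists>r. strict_mono r \<and> MCauchy (s \<circ> r)" by blast
  qed auto
  from recurrent_orbit_bounded[OF f z this rec]
  obtain B where B: "\<And>n. d ((f ^^ n) z) z \<le> B" by blast
  have "orbit_of f x \<subseteq> mcball z (d x z + B)"
  proof
    fix p assume "p \<in> orbit_of f x"
    then obtain n where p: "p = (f ^^ n) x" by (auto simp: orbit_of_def)
    have "d p z \<le> d ((f ^^ n) x) ((f ^^ n) z) + d ((f ^^ n) z) z"
      unfolding p using triangle mem x z by simp
    also have "\<dots> \<le> d x z + B"
      using nonexpansive_iterate[OF f x z, of n] B[of n] by simp
    finally show "p \<in> mcball z (d x z + B)" using p mem x z by (simp add: commute)
  qed
  with unb show False by (auto simp: mbounded_def)
qed

end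

section \<open>Compactifications whose boundary is at infinity\<close>

locale metric_compactification = Metric_space Y d
  for Y :: "'a set" and d :: "'a \<Rightarrow> 'a \<Rightarrow> real" +
  fixes Yb :: "'a set" and db :: "'a \<Rightarrow> 'a \<Rightarrow> real"
  assumes axiom1: "axiom1 Y d Yb db"
begin

sublocale Yb: Metric_space Yb db
  using axiom1 by (simp add: axiom1_def)

lemma Y_subset_Yb: "Y \<subseteq> Yb"
  using axiom1 openin_subset[of Yb.mtopology Y] by (simp add: axiom1_def)

lemma db_commute: "db x y = db y x"
  by (rule Yb.commute)

lemma limitin_Yb_iff:
  assumes "range x \<subseteq> Y" "\<xi> \<in> Yb"
  shows "limitin Yb.mtopology x \<xi> sequentially \<longleftrightarrow> (\<lambda>n. db (x n) \<xi>) \<longlonglongrightarrow> 0"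
proof -
  have "x n \<in> Yb" for n using assms(1) Y_subset_Yb by auto
  then show ?thesis using assms(2) by (simp add: Yb.limitin_metric_dist_null)
qed

lemma tendsto_interior_iff:
  assumes "range x \<subseteq> Y" "z \<in> Y"
  shows "(\<lambda>n. db (x n) z) \<longlonglongrightarrow> 0 \<longleftrightarrow> (\<lambda>n. d (x n) z) \<longlonglongrightarrow> 0"
proof -
  have xY: "x n \<in> Y" for n using assms(1) by auto
  have "(\<lambda>n. db (x n) z) \<longlonglongrightarrow> 0 \<longleftrightarrow> limitin Yb.mtopology x z sequentially"
    using limitin_Yb_iff assms Y_subset_Yb by blast
  also have "\<dots> \<longleftrightarrow> limitin (subtopology Yb.mtopology Y) x z sequentially"
    using xY assms(2) by (simp add: limitin_subtopology)
  also have "\<dots> \<longleftrightarrow> limitin mtopology x z sequentially"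
    using axiom1 by (simp add: axiom1_def)
  also have "\<dots> \<longleftrightarrow> (\<lambda>n. d (x n) z) \<longlonglongrightarrow> 0"
    using xY assms(2) by (simp add: limitin_metric_dist_null)
  finally show ?thesis .
qed

lemma tendsto_boundary_escapes:
  assumes "range x \<subseteq> Y" "\<xi> \<in> Yb - Y" "(\<lambda>n. db (x n) \<xi>) \<longlonglongrightarrow> 0" "w \<in> Y"
  shows "filterlim (\<lambda>n. d (x n) w) at_top sequentially"
  using axiom1 assms limitin_Yb_iff[of x \<xi>] unfolding axiom1_def by blast

lemma convergent_subseq:
  assumes "range x \<subseteq> Y"
  shows "\<exists>\<xi> (r::nat \<Rightarrow> nat). \<xi> \<in> Yb \<and> strict_mono r \<and> (\<lambda>n. db (x (r n)) \<xi>) \<longlonglongrightarrow> 0"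
proof -
  have "compact_space Yb.mtopology" using axiom1 by (simp add: axiom1_def)
  moreover have "range x \<subseteq> Yb" using assms Y_subset_Yb by blast
  ultimately obtain \<xi> and r :: "nat \<Rightarrow> nat" where *: "\<xi> \<in> Yb" "strict_mono r"
    "limitin Yb.mtopology (x \<circ> r) \<xi> sequentially"
    unfolding Yb.compact_space_sequentially by blast
  have "range (x \<circ> r) \<subseteq> Y" using assms by auto
  with * show ?thesis using limitin_Yb_iff[of "x \<circ> r" \<xi>] by (auto simp: o_def)
qed

lemma tendsto_subseq:
  assumes "(\<lambda>n. db (x n) \<xi>) \<longlonglongrightarrow> 0" "strict_mono r"
  shows "(\<lambda>n. db (x (r n)) \<xi>) \<longlonglongrightarrow> 0"
  using LIMSEQ_subseq_LIMSEQ[OF assms] by (simp add: o_def)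

lemma limit_unique:
  assumes "range x \<subseteq> Y" "\<xi> \<in> Yb" "\<eta> \<in> Yb"
    "(\<lambda>n. db (x n) \<xi>) \<longlonglongrightarrow> 0" "(\<lambda>n. db (x n) \<eta>) \<longlonglongrightarrow> 0"
  shows "\<xi> = \<eta>"
  using Yb.limitin_metric_unique[of x \<xi> sequentially \<eta>] limitin_Yb_iff assms by simp

lemma tendsto_db:
  assumes "range x \<subseteq> Y" "\<xi> \<in> Yb" "\<eta> \<in> Yb" "(\<lambda>n. db (x n) \<xi>) \<longlonglongrightarrow> 0"
  shows "(\<lambda>n. db (x n) \<eta>) \<longlonglongrightarrow> db \<xi> \<eta>"
proof (rule LIM_zero_cancel, rule tendsto_rabs_zero_cancel)
  have "\<bar>db (x n) \<eta> - db \<xi> \<eta>\<bar> \<le> db (x n) \<xi>" for n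
  proof -
    have "x n \<in> Yb" using assms(1) Y_subset_Yb by auto
    then show ?thesis
      using Yb.triangle[of "x n" \<xi> \<eta>] Yb.triangle[of \<xi> "x n" \<eta>] assms(2,3) db_commute[of \<xi> "x n"]
      by simp
  qed
  then show "(\<lambda>n. \<bar>db (x n) \<eta> - db \<xi> \<eta>\<bar>) \<longlonglongrightarrow> 0"
    by (intro tendsto_sandwich[OF _ _ tendsto_const assms(4)]) auto
qed

text \<open>
  The space is proper: a bounded sequence clusters somewhere in the compactification, but
  not on the boundary, where distances blow up.
\<close>

lemma bounded_convergent_subseq:
  assumes "range s \<subseteq> Y" "w \<in> Y" "\<And>n. d (s n) w \<le> R"
  shows "\<exists>z (r::nat \<Rightarrow> nat). z \<in> Y \<and> strict_mono r \<and> (\<lambda>n. d (s (r n)) z) \<longlonglongrightarrow> 0"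
proof -
  obtain z and r :: "nat \<Rightarrow> nat" where z: "z \<in> Yb" "strict_mono r" "(\<lambda>n. db (s (r n)) z) \<longlonglongrightarrow> 0"
    using convergent_subseq[OF assms(1)] by blast
  have sr: "range (\<lambda>n. s (r n)) \<subseteq> Y" using assms(1) by auto
  have "z \<in> Y"
  proof (rule ccontr)
    assume "z \<notin> Y"
    with z have "filterlim (\<lambda>n. d (s (r n)) w) at_top sequentially"
      using tendsto_boundary_escapes[OF sr _ z(3) assms(2)] by simp
    then have "\<exists>n. R < d (s (r n)) w"
      by (auto simp: filterlim_at_top_dense eventually_sequentially)
    with assms(3) show False by (auto simp: not_le[symmetric])
  qed
  with z tendsto_interior_iff[OF sr] show ?thesis by blast
qed

lemma continuous_db_along_geodesic:
  assumes "geodesic Y d a b \<sigma>" "\<eta> \<in> Yb"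
  shows "continuous_on {a..b} (\<lambda>t. db (\<sigma> t) \<eta>)"
  unfolding continuous_on_sequentially
proof (intro allI ballI impI)
  fix u t assume t: "t \<in> {a..b}" and u: "(\<forall>n. u n \<in> {a..b}) \<and> u \<longlonglongrightarrow> t"
  have \<sigma>Y: "\<sigma> s \<in> Y" if "s \<in> {a..b}" for s using assms(1) that by (auto simp: geodesic_def)
  have rng: "range (\<lambda>n. \<sigma> (u n)) \<subseteq> Y" using \<sigma>Y u by auto
  have "d (\<sigma> (u n)) (\<sigma> t) = \<bar>u n - t\<bar>" for n
    using assms(1) u t by (auto simp: geodesic_def)
  moreover have "(\<lambda>n. \<bar>u n - t\<bar>) \<longlonglongrightarrow> 0"
    using u by (intro tendsto_rabs_zero LIM_zero) auto
  ultimately have "(\<lambda>n. d (\<sigma> (u n)) (\<sigma> t)) \<longlonglongrightarrow> 0" by simp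
  then have "(\<lambda>n. db (\<sigma> (u n)) (\<sigma> t)) \<longlonglongrightarrow> 0"
    using tendsto_interior_iff[OF rng \<sigma>Y[OF t]] by simp
  then show "((\<lambda>t. db (\<sigma> t) \<eta>) \<circ> u) \<longlonglongrightarrow> db (\<sigma> t) \<eta>"
    using tendsto_db[OF rng _ assms(2)] \<sigma>Y[OF t] Y_subset_Yb by (auto simp: o_def)
qed

lemma geodesic_crosses_sphere:
  assumes "geodesic_space Y d" "y \<in> Y" "z \<in> Y" "\<eta> \<in> Yb" "db y \<eta> \<le> \<rho>" "\<rho> \<le> db z \<eta>"
  shows "\<exists>p\<in>Y. d y p + d p z = d y z \<and> db p \<eta> = \<rho>"
proof -
  from assms(1-3) obtain a b \<sigma> where g: "geodesic Y d a b \<sigma>" "\<sigma> a = y" "\<sigma> b = z"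
    unfolding geodesic_space_def by blast
  have "a \<le> b" using g(1) by (simp add: geodesic_def)
  then obtain t where t: "a \<le> t" "t \<le> b" "db (\<sigma> t) \<eta> = \<rho>"
    using IVT'[of "\<lambda>t. db (\<sigma> t) \<eta>" a \<rho> b] continuous_db_along_geodesic[OF g(1) assms(4)]
      assms(5,6) g(2,3) by auto
  have "\<sigma> t \<in> Y" using g(1) t by (auto simp: geodesic_def)
  moreover have "d y (\<sigma> t) + d (\<sigma> t) z = d y z"
    using g t \<open>a \<le> b\<close> by (auto simp: geodesic_def)
  ultimately show ?thesis using t(3) by blast
qed

end

section \<open>Points going to different boundary points have bounded Gromov product\<close>

locale geodesic_compactification = metric_compactification Y d Yb db
  for Y :: "'a set" and d :: "'a \<Rightarrow> 'a \<Rightarrow> real" and Yb :: "'a set" and db :: "'a \<Rightarrow> 'a \<Rightarrow> real" +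
  assumes geodesic: "geodesic_space Y d" and axiom3: "axiom3 Y d Yb db"
begin

lemma tendsto_boundary_transfer:
  assumes "range x \<subseteq> Y" "range y \<subseteq> Y" "\<xi> \<in> Yb - Y" "w \<in> Y"
    and "(\<lambda>n. db (x n) \<xi>) \<longlonglongrightarrow> 0"
    and "filterlim (\<lambda>n. d (x n) (y n) - d (y n) w) at_bot sequentially"
  shows "(\<lambda>n. db (y n) \<xi>) \<longlonglongrightarrow> 0"
proof -
  have "\<xi> \<in> Yb" using assms(3) by simp
  then have "limitin Yb.mtopology y \<xi> sequentially"
    using axiom3 assms limitin_Yb_iff[of x \<xi>] unfolding axiom3_def by blast
  then show ?thesis using limitin_Yb_iff[of y \<xi>] assms(2) \<open>\<xi> \<in> Yb\<close> by blast
qed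

text \<open>
  Axiom 3 read contrapositively. As it only excludes that \<open>d (x n) (y n) - d (y n) w\<close> tends to
  \<open>-\<infinity>\<close>, the lower bound holds along a subsequence.
\<close>

lemma distinct_limits_far_apart:
  assumes "range x \<subseteq> Y" "range y \<subseteq> Y" "\<xi> \<in> Yb - Y" "\<eta> \<in> Yb" "\<xi> \<noteq> \<eta>" "w \<in> Y"
    and x: "(\<lambda>n. db (x n) \<xi>) \<longlonglongrightarrow> 0" and y: "(\<lambda>n. db (y n) \<eta>) \<longlonglongrightarrow> 0"
  shows "\<exists>(r::nat \<Rightarrow> nat) C. strict_mono r \<and> (\<forall>n. d (y (r n)) w - C \<le> d (x (r n)) (y (r n)))"
proof -
  have "\<not> filterlim (\<lambda>n. d (x n) (y n) - d (y n) w) at_bot sequentially"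
  proof
    assume "filterlim (\<lambda>n. d (x n) (y n) - d (y n) w) at_bot sequentially"
    then have "(\<lambda>n. db (y n) \<xi>) \<longlonglongrightarrow> 0"
      using tendsto_boundary_transfer assms by blast
    then show False using limit_unique[of y \<xi> \<eta>] assms by auto
  qed
  from bounded_below_subseq[OF this] obtain r :: "nat \<Rightarrow> nat" and C where "strict_mono r"
    "\<And>n. C \<le> d (x (r n)) (y (r n)) - d (y (r n)) w" by blast
  then show ?thesis by (intro exI[of _ r] exI[of _ "-C"]) (auto simp: algebra_simps)
qed

text \<open>
  This is where geodesics enter; Axiom 3 alone only gives,
  along a subsequence, \<open>d (y n) (z n) \<ge> max (d (y n) w) (d (z n) w) - C\<close>. The geodesic from \<open>y n\<close> to \<open>z n\<close> passes
  through a point \<open>p n\<close> whose \<open>db\<close>-distance from \<open>\<eta>\<close> is half that of \<open>\<xi>\<close>, so the \<open>p n\<close> cluster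
  at a point \<open>\<zeta>\<close> different from both. Either \<open>\<zeta>\<close> lies in \<open>Y\<close> and the \<open>p n\<close> stay near \<open>w\<close>, or it lies on
  the boundary and Axiom 3 separates \<open>p n\<close> from \<open>y n\<close> and from \<open>z n\<close>. In both cases
  \<open>d (y n) (z n) = d (y n) (p n) + d (p n) (z n)\<close> is large.
\<close>

lemma distinct_limits_bounded_Gromov_product:
  assumes y: "range y \<subseteq> Y" "\<eta> \<in> Yb - Y" "(\<lambda>n. db (y n) \<eta>) \<longlonglongrightarrow> 0"
    and z: "range z \<subseteq> Y" "\<xi> \<in> Yb - Y" "(\<lambda>n. db (z n) \<xi>) \<longlonglongrightarrow> 0"
    and "\<xi> \<noteq> \<eta>" and w: "w \<in> Y"
  shows "\<exists>(r::nat \<Rightarrow> nat) C. strict_mono r \<and>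
    (\<forall>n. d (y (r n)) w + d (z (r n)) w - C \<le> d (y (r n)) (z (r n)))"
proof -
  have bd: "\<xi> \<in> Yb" "\<eta> \<in> Yb" using y z by auto
  define \<rho> where "\<rho> = db \<xi> \<eta> / 2"
  have "\<rho> > 0" using \<open>\<xi> \<noteq> \<eta>\<close> bd by (simp add: \<rho>_def less_le Yb.nonneg)
  have yY: "y n \<in> Y" and zY: "z n \<in> Y" for n using y z by auto
  have "\<forall>\<^sub>F n in sequentially. db (y n) \<eta> < \<rho>"
    by (rule order_tendstoD(2)[OF y(3) \<open>\<rho> > 0\<close>])
  moreover have "\<forall>\<^sub>F n in sequentially. \<rho> < db (z n) \<eta>"
    by (rule order_tendstoD(1)[OF tendsto_db[OF z(1) bd z(3)]])
      (use \<open>\<rho> > 0\<close> in \<open>simp add: \<rho>_def\<close>)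
  ultimately have "\<forall>\<^sub>F n in sequentially. db (y n) \<eta> < \<rho> \<and> \<rho> < db (z n) \<eta>"
    by (rule eventually_conj)
  then obtain N where "\<And>n. n \<ge> N \<Longrightarrow> db (y n) \<eta> < \<rho> \<and> \<rho> < db (z n) \<eta>"
    by (auto simp: eventually_sequentially)
  then have "\<exists>p\<in>Y. d (y (n + N)) p + d p (z (n + N)) = d (y (n + N)) (z (n + N)) \<and> db p \<eta> = \<rho>"
    for n
    using geodesic_crosses_sphere[OF geodesic yY zY bd(2)] by (simp add: less_imp_le)
  then obtain p where pY: "\<And>n. p n \<in> Y"
    and pgeo: "\<And>n. d (y (n + N)) (p n) + d (p n) (z (n + N)) = d (y (n + N)) (z (n + N))"
    and p\<rho>: "\<And>n. db (p n) \<eta> = \<rho>" by metis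
  from convergent_subseq[of p] pY obtain \<zeta> and q :: "nat \<Rightarrow> nat" where \<zeta>: "\<zeta> \<in> Yb" and q: "strict_mono q"
    and lim: "(\<lambda>n. db (p (q n)) \<zeta>) \<longlonglongrightarrow> 0" by blast
  have "(\<lambda>n. db (p (q n)) \<eta>) \<longlonglongrightarrow> db \<zeta> \<eta>"
    using tendsto_db[OF _ \<zeta> bd(2) lim] pY by blast
  then have "db \<zeta> \<eta> = \<rho>" using p\<rho> by (simp add: LIMSEQ_const_iff)
  then have ne: "\<zeta> \<noteq> \<eta>" "\<zeta> \<noteq> \<xi>" using \<open>\<rho> > 0\<close> bd by (auto simp: \<rho>_def)
  define r where "r n = q n + N" for n
  have r: "strict_mono r" using q by (simp add: r_def strict_mono_def)
  have geo: "d (y (r n)) (p (q n)) + d (p (q n)) (z (r n)) = d (y (r n)) (z (r n))" for n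
    using pgeo by (simp add: r_def)
  note limy = tendsto_subseq[OF y(3) r] and limz = tendsto_subseq[OF z(3) r]
  show ?thesis
  proof (cases "\<zeta> \<in> Y")
    case True
    then have "(\<lambda>n. d (p (q n)) \<zeta>) \<longlonglongrightarrow> 0"
      using tendsto_interior_iff[of "\<lambda>n. p (q n)" \<zeta>] lim pY by auto
    then have "Bseq (\<lambda>n. d (p (q n)) \<zeta>)" by (intro convergent_imp_Bseq convergentI)
    then obtain B where B: "\<And>n. d (p (q n)) \<zeta> \<le> B" by (auto simp: Bseq_def)
    have "d (y (r n)) w + d (z (r n)) w - 2 * (B + d \<zeta> w) \<le> d (y (r n)) (z (r n))" for n
      using geo[of n] B[of n] triangle[of "y (r n)" "p (q n)" w] triangle[of "z (r n)" "p (q n)" w]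
        triangle[of "p (q n)" \<zeta> w] commute[of "z (r n)" "p (q n)"] pY yY zY w True
      by simp
    with r show ?thesis by blast
  next
    case False
    with \<zeta> have \<zeta>': "\<zeta> \<in> Yb - Y" by simp
    have rng: "range (\<lambda>n. p (q n)) \<subseteq> Y" "range (\<lambda>n. y (r n)) \<subseteq> Y" using pY yY by auto
    from distinct_limits_far_apart[OF rng \<zeta>' bd(2) ne(1) w lim limy]
    obtain s :: "nat \<Rightarrow> nat" and C where s: "strict_mono s"
      and C: "\<And>n. d (y (r (s n))) w - C \<le> d (p (q (s n))) (y (r (s n)))" by blast
    have rng': "range (\<lambda>n. p (q (s n))) \<subseteq> Y" "range (\<lambda>n. z (r (s n))) \<subseteq> Y" using pY zY by auto
    from distinct_limits_far_apart[OF rng' \<zeta>' bd(1) ne(2) w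
        tendsto_subseq[OF lim s] tendsto_subseq[OF limz s]]
    obtain t :: "nat \<Rightarrow> nat" and D where t: "strict_mono t"
      and D: "\<And>n. d (z (r (s (t n)))) w - D \<le> d (p (q (s (t n)))) (z (r (s (t n))))" by blast
    have "d (y (r (s (t n)))) w + d (z (r (s (t n)))) w - (C + D)
        \<le> d (y (r (s (t n)))) (z (r (s (t n))))" for n
      using geo[of "s (t n)"] C[of "t n"] D[of n] commute[of "p (q (s (t n)))" "y (r (s (t n)))"]
      by simp
    moreover have "strict_mono (\<lambda>n. r (s (t n)))"
      using r s t by (simp add: strict_mono_def)
    ultimately show ?thesis by (intro exI[of _ "\<lambda>n. r (s (t n))"]) blast
  qed
qed

section \<open>Convergence of the iterates\<close>

lemma escaping_limit_in_boundary:
  assumes "range x \<subseteq> Y" "\<xi> \<in> Yb" "(\<lambda>n. db (x n) \<xi>) \<longlonglongrightarrow> 0" "w \<in> Y"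
    and esc: "filterlim (\<lambda>n. d (x n) w) at_top sequentially"
  shows "\<xi> \<in> Yb - Y"
proof (rule ccontr)
  assume "\<not> ?thesis"
  with assms have \<xi>: "\<xi> \<in> Y" by simp
  then have "(\<lambda>n. d (x n) \<xi>) \<longlonglongrightarrow> 0" using tendsto_interior_iff assms by blast
  then have "\<forall>\<^sub>F n in sequentially. d (x n) \<xi> < 1" by (rule order_tendstoD(2)) simp
  moreover have "\<forall>\<^sub>F n in sequentially. 1 + d \<xi> w < d (x n) w"
    using esc by (simp add: filterlim_at_top_dense)
  ultimately have "\<forall>\<^sub>F n in sequentially. False"
  proof eventually_elim
    case (elim n)
    have "x n \<in> Y" using assms(1) by auto
    with elim triangle[of "x n" \<xi> w] \<xi> \<open>w \<in> Y\<close> show False by simp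
  qed
  then show False by simp
qed

text \<open>
  Suppose that \<open>f\<^sup>n x\<close> along record times \<open>n\<close> and \<open>f\<^sup>k x\<close> along other times \<open>k\<close> go to different
  boundary points. For a record time \<open>n \<ge> k\<close> nonexpansiveness bounds the distance of the two points
  by the displacement after \<open>n - k\<close> steps, hence by \<open>d (f\<^sup>n x) x\<close>, while the bounded Gromov product
  makes it at least \<open>d (f\<^sup>n x) x + d (f\<^sup>k x) x - C\<close>. So \<open>d (f\<^sup>k x) x \<le> C\<close>, although the orbit escapes.
\<close>

lemma orbit_converges_to_boundary:
  assumes f: "nonexpansive Y d f" and x: "x \<in> Y"
    and esc: "filterlim (\<lambda>n. d ((f ^^ n) x) x) at_top sequentially"
  shows "\<exists>\<xi>\<in>Yb - Y. (\<lambda>n. db ((f ^^ n) x) \<xi>) \<longlonglongrightarrow> 0"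
proof -
  have mem: "(f ^^ k) x \<in> Y" for k using nonexpansive_iterate_mem[OF f x] .
  have esc': "filterlim (\<lambda>n. d ((f ^^ r n) x) x) at_top sequentially" if "strict_mono r" for r
    using filterlim_compose[OF esc filterlim_subseq[OF that]] .
  from record_times_subseq[OF esc] obtain r0 :: "nat \<Rightarrow> nat" where r0: "strict_mono r0"
    and max_at0: "\<And>n m. m \<le> r0 n \<Longrightarrow> d ((f ^^ m) x) x \<le> d ((f ^^ r0 n) x) x" by blast
  from convergent_subseq[of "\<lambda>n. (f ^^ r0 n) x"] mem obtain \<xi> and q :: "nat \<Rightarrow> nat"
    where "\<xi> \<in> Yb" and q: "strict_mono q" and lim0: "(\<lambda>n. db ((f ^^ r0 (q n)) x) \<xi>) \<longlonglongrightarrow> 0"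
    by blast
  define r where "r n = r0 (q n)" for n
  have r: "strict_mono r" using r0 q by (simp add: r_def strict_mono_def)
  have max_at: "d ((f ^^ m) x) x \<le> d ((f ^^ r n) x) x" if "m \<le> r n" for n m
    using max_at0 that by (simp add: r_def)
  have lim: "(\<lambda>n. db ((f ^^ r n) x) \<xi>) \<longlonglongrightarrow> 0" using lim0 by (simp add: r_def)
  have \<xi>: "\<xi> \<in> Yb - Y"
    using escaping_limit_in_boundary[OF _ \<open>\<xi> \<in> Yb\<close> lim x esc'[OF r]] mem by blast
  have "(\<lambda>n. db ((f ^^ n) x) \<xi>) \<longlonglongrightarrow> 0"
  proof (rule ccontr)
    assume "\<not> ?thesis"
    then obtain e where "e > 0" and e: "\<And>N. \<exists>n\<ge>N. e \<le> db ((f ^^ n) x) \<xi>"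
      by (auto simp: LIMSEQ_def not_less Yb.nonneg)
    from subseq_of_frequent[of "\<lambda>n. e \<le> db ((f ^^ n) x) \<xi>", OF e]
    obtain k0 :: "nat \<Rightarrow> nat" where k0: "strict_mono k0" and far0: "\<And>n. e \<le> db ((f ^^ k0 n) x) \<xi>" by blast
    from convergent_subseq[of "\<lambda>n. (f ^^ k0 n) x"] mem obtain \<eta> and q' :: "nat \<Rightarrow> nat"
      where "\<eta> \<in> Yb" and q': "strict_mono q'"
        and lim1: "(\<lambda>n. db ((f ^^ k0 (q' n)) x) \<eta>) \<longlonglongrightarrow> 0" by blast
    define k where "k n = k0 (q' n)" for n
    have k: "strict_mono k" using k0 q' by (simp add: k_def strict_mono_def)
    have limk: "(\<lambda>n. db ((f ^^ k n) x) \<eta>) \<longlonglongrightarrow> 0" using lim1 by (simp add: k_def)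
    have far: "e \<le> db ((f ^^ k n) x) \<xi>" for n using far0 by (simp add: k_def)
    have \<eta>: "\<eta> \<in> Yb - Y"
      using escaping_limit_in_boundary[OF _ \<open>\<eta> \<in> Yb\<close> limk x esc'[OF k]] mem by blast
    have "\<xi> \<noteq> \<eta>"
    proof
      assume "\<xi> = \<eta>"
      with limk have "(\<lambda>n. db ((f ^^ k n) x) \<xi>) \<longlonglongrightarrow> 0" by simp
      from LIMSEQ_le_const[OF this, of e] far \<open>e > 0\<close> show False by auto
    qed
    (* Indexing the record times by k makes the record time r (k n) at least k n. *)
    have "\<exists>(s::nat \<Rightarrow> nat) C. strict_mono s \<and> (\<forall>n. d ((f ^^ k (s n)) x) x + d ((f ^^ r (k (s n))) x) x - C
        \<le> d ((f ^^ k (s n)) x) ((f ^^ r (k (s n))) x))"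
      by (rule distinct_limits_bounded_Gromov_product[OF _ \<eta> limk _ \<xi> _ \<open>\<xi> \<noteq> \<eta>\<close> x])
        (use mem tendsto_subseq[OF lim k] in auto)
    then obtain s :: "nat \<Rightarrow> nat" and C where s: "strict_mono s" and C:
      "\<And>n. d ((f ^^ k (s n)) x) x + d ((f ^^ r (k (s n))) x) x - C
        \<le> d ((f ^^ k (s n)) x) ((f ^^ r (k (s n))) x)" by blast
    have bound: "d ((f ^^ k (s n)) x) x \<le> C" for n
    proof -
      have "k (s n) \<le> r (k (s n))" by (rule seq_suble[OF r])
      from nonexpansive_orbit_dist_le[OF f x this] max_at[of "r (k (s n)) - k (s n)" "k (s n)"]
      have "d ((f ^^ r (k (s n))) x) ((f ^^ k (s n)) x) \<le> d ((f ^^ r (k (s n))) x) x" by simp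
      with C[of n] show ?thesis by (simp add: commute)
    qed
    have "strict_mono (\<lambda>n. k (s n))" using k s by (simp add: strict_mono_def)
    from esc'[OF this] have "\<exists>n. C < d ((f ^^ k (s n)) x) x"
      by (auto simp: filterlim_at_top_dense eventually_sequentially)
    with bound show False by (auto simp: not_le[symmetric])
  qed
  with \<xi> show ?thesis by blast
qed

text \<open>
  Iterates of points of a bounded set stay within bounded distance of \<open>f\<^sup>n x\<close>, so Axiom 3 sends them
  to the same limit; applying this to points that nearly realize the suprema gives uniformity.
\<close>

lemma orbit_limit_uniform_on_bounded:
  assumes f: "nonexpansive Y d f" and x: "x \<in> Y" and \<xi>: "\<xi> \<in> Yb - Y"
    and lim: "(\<lambda>n. db ((f ^^ n) x) \<xi>) \<longlonglongrightarrow> 0"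
  shows "iterates_converge_uniformly_on_bounded_sets Y d db f \<xi>"
  unfolding iterates_converge_uniformly_on_bounded_sets_def
proof (intro allI impI)
  fix K assume "K \<subseteq> Y" and "mbounded K"
  then obtain c B where "K \<subseteq> mcball c B" by (auto simp: mbounded_def)
  then have R: "d x y \<le> d x c + B" if "y \<in> K" for y
    using that triangle[of x c y] x by (auto simp: subset_iff)
  define R where "R = d x c + B"
  have mem: "(f ^^ k) y \<in> Y" if "y \<in> Y" for k y using nonexpansive_iterate_mem[OF f that] .
  have pointwise: "(\<lambda>n. db ((f ^^ n) (y n)) \<xi>) \<longlonglongrightarrow> 0" if y: "\<And>n. y n \<in> insert x K" for y
  proof (rule tendsto_boundary_transfer[OF _ _ \<xi> x lim])
    have yY: "y n \<in> Y" for n using y[of n] x \<open>K \<subseteq> Y\<close> by auto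
    show "range (\<lambda>n. (f ^^ n) x) \<subseteq> Y" "range (\<lambda>n. (f ^^ n) (y n)) \<subseteq> Y"
      using mem x yY by auto
    have esc: "filterlim (\<lambda>n. d ((f ^^ n) x) x) at_top sequentially"
      using tendsto_boundary_escapes[OF _ \<xi> lim x] mem[OF x] by blast
    have le: "d ((f ^^ n) x) ((f ^^ n) (y n)) - d ((f ^^ n) (y n)) x
        \<le> 2 * max 0 R - d ((f ^^ n) x) x" for n
    proof -
      have "d ((f ^^ n) x) ((f ^^ n) (y n)) \<le> max 0 R"
        using nonexpansive_iterate[OF f x yY, of n n] R[of "y n"] y[of n] x
        by (auto simp: R_def)
      with triangle[of "(f ^^ n) x" "(f ^^ n) (y n)" x] mem x yY show ?thesis
        by (smt (verit, best))
    qed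
    show "filterlim (\<lambda>n. d ((f ^^ n) x) ((f ^^ n) (y n)) - d ((f ^^ n) (y n)) x) at_bot sequentially"
      unfolding filterlim_at_bot
    proof
      fix Z
      have "\<forall>\<^sub>F n in sequentially. 2 * max 0 R - Z \<le> d ((f ^^ n) x) x"
        using esc by (simp add: filterlim_at_top)
      then show "\<forall>\<^sub>F n in sequentially. d ((f ^^ n) x) ((f ^^ n) (y n)) - d ((f ^^ n) (y n)) x \<le> Z"
      proof (rule eventually_mono)
        show "d ((f ^^ n) x) ((f ^^ n) (y n)) - d ((f ^^ n) (y n)) x \<le> Z"
          if "2 * max 0 R - Z \<le> d ((f ^^ n) x) x" for n
          using le[of n] that by linarith
      qed
    qed
  qed
  have unif: "\<exists>N. \<forall>n\<ge>N. \<forall>y\<in>K. db ((f ^^ n) y) \<xi> < e" if "e > 0" for e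
  proof -
    (* A point of K violating the bound at time n, if there is one, and x otherwise. *)
    define y where "y n = (if \<exists>y\<in>K. e \<le> db ((f ^^ n) y) \<xi>
      then SOME y. y \<in> K \<and> e \<le> db ((f ^^ n) y) \<xi> else x)" for n
    have y: "y n \<in> K \<and> e \<le> db ((f ^^ n) (y n)) \<xi>" if "\<exists>y\<in>K. e \<le> db ((f ^^ n) y) \<xi>" for n
      using someI_ex[of "\<lambda>y. y \<in> K \<and> e \<le> db ((f ^^ n) y) \<xi>"] that
      unfolding y_def by (simp only: if_True) blast
    have "y n \<in> insert x K" for n
    proof (cases "\<exists>y\<in>K. e \<le> db ((f ^^ n) y) \<xi>")
      case False
      then show ?thesis by (simp only: y_def if_False insertI1)
    qed (use y in blast)
    from order_tendstoD(2)[OF pointwise[of y, OF this] \<open>e > 0\<close>]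
    obtain N where "\<And>n. n \<ge> N \<Longrightarrow> db ((f ^^ n) (y n)) \<xi> < e"
      by (auto simp: eventually_sequentially)
    then have "\<forall>n\<ge>N. \<forall>u\<in>K. db ((f ^^ n) u) \<xi> < e" using y by (meson not_less)
    then show ?thesis by blast
  qed
  show "(\<lambda>n. SUP y\<in>K. ennreal (db ((f ^^ n) y) \<xi>)) \<longlonglongrightarrow> 0"
  proof (rule tendsto_0_if_Limsup_eq_0_ennreal, rule antisym)
    show "Limsup sequentially (\<lambda>n. SUP y\<in>K. ennreal (db ((f ^^ n) y) \<xi>)) \<le> 0"
    proof (rule ennreal_le_epsilon)
      fix e :: real assume "e > 0"
      from unif[OF this] have "\<forall>\<^sub>F n in sequentially. (SUP y\<in>K. ennreal (db ((f ^^ n) y) \<xi>)) \<le> ennreal e"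
        unfolding eventually_sequentially by (meson SUP_least ennreal_leI less_imp_le)
      then show "Limsup sequentially (\<lambda>n. SUP y\<in>K. ennreal (db ((f ^^ n) y) \<xi>)) \<le> 0 + ennreal e"
        by (simp add: Limsup_bounded)
    qed
  qed simp
qed

end

theorem theorem3p5:
  fixes Y Yb :: "'a set" and d db :: "'a \<Rightarrow> 'a \<Rightarrow> real" and f :: "'a \<Rightarrow> 'a"
  assumes "Metric_space Y d" and "Y \<noteq> {}"
    and "Metric_space.mcomplete Y d"
    and "locally_compact_space (Metric_space.mtopology Y d)"
    and "geodesic_space Y d"
    and "axiom1 Y d Yb db"
    and "axiom3 Y d Yb db"
    and "nonexpansive Y d f"
    and "without_bounded_orbits Y d f"
  shows "\<exists>\<xi>\<in>Yb - Y. iterates_converge_uniformly_on_bounded_sets Y d db f \<xi>"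
proof -
  interpret Metric_space Y d by fact
  interpret geodesic_compactification Y d Yb db
    by unfold_locales (use assms in auto)
  obtain x where x: "x \<in> Y" using assms(2) by blast
  have "filterlim (\<lambda>n. d ((f ^^ n) x) x) at_top sequentially"
  proof (rule unbounded_orbit_escapes[OF assms(8) x])
    show "\<not> mbounded (orbit_of f x)" using assms(9) x by (simp add: without_bounded_orbits_def)
    show "\<exists>z (r::nat \<Rightarrow> nat). z \<in> Y \<and> strict_mono r \<and> (\<lambda>n. d (s (r n)) z) \<longlonglongrightarrow> 0"
      if "range s \<subseteq> Y" "w \<in> Y" "\<And>n. d (s n) w \<le> R" for s w R
      by (rule bounded_convergent_subseq[OF that])
  qed
  from orbit_converges_to_boundary[OF assms(8) x this] show ?thesis
    using orbit_limit_uniform_on_bounded[OF assms(8) x] by blast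
qed

end
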